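(* For any primitive set $A\subset\mathbb{Z}_{>1}$ with $2\notin A$, we have $f(A)<1.60$, where $f(A)=\sum_{a\in A}\frac{1}{a\log a}$.
   Context: A set $A\subset\mathbb{Z}_{>1}$ is primitive if no member of $A$ divides another member of $A$. *)

theory Defs
  imports "HOL-Analysis.Analysis"
begin

definition primitive :: "nat set \<Rightarrow> bool" where
  "primitive A \<longleftrightarrow> A \<subseteq> {2..} \<and> (\<forall>a\<in>A. \<forall>b\<in>A. a dvd b \<longrightarrow> a = b)"

definition erdos_sum :: "nat set \<Rightarrow> real" where
  "erdos_sum A = (\<Sum>\<^sub>\<infinity>a\<in>A. 1 / (real a * ln (real a)))"

end

(*
Let L be the von Mangoldt function and F(n) = 1/(n log n). Since the sum of L(q) over q | n is log n,
the transitions n -> n/q with probability L(q)/log n define a Markov chain that descends to 1.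
Starting it from every a in A with mass F(a), let mu(m) be the total mass passing through m; then
mu(1) is the sum of F over A. As A is primitive, no mass passes strictly through an element of A,
and the bound S(n) := sum_{k <= n} L(k)/k <= log n shows by partial summation that F is superharmonic
for the chain, so mu(m) <= F(m) for m >= 2. If 2 is not in A, then mu(2) is at most the inflow of F
into 2, and adding up the mass that reaches 1 from the prime powers gives
  f(A) <= sum_{q > 2} L(q)/(q log^2 q) + (1/2) sum_q L(q)/(q log^2 (2q)).
The terms q <= 16 are estimated individually and the tail again by the bound on S.

That bound comes from n S(n) - log n! = sum_{k <= n} L(k) {n/k}, where {n/k} <= min(n/k - 1, 1), and
psi(n) <= n log 4: partial summation bounds the right-hand side by (2 log^2 2) n < 0.962 n, which
Stirling's formula absorbs once n >= 83.
*)

theory Submission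
  imports Defs "HOL-Number_Theory.Number_Theory"
begin

section \<open>Partial summation and Chebyshev's bound\<close>

definition chebyshev_psi :: "nat \<Rightarrow> real" where
  "chebyshev_psi n = (\<Sum>k=1..n. mangoldt k)"

definition mertens_sum :: "nat \<Rightarrow> real" where
  "mertens_sum n = (\<Sum>k=1..n. mangoldt k / real k)"

text \<open>Abel summation as an inequality: a comparison of partial sums survives a nonincreasing
  nonnegative weight, and the initial allowance \<open>c\<close> is charged only at the first
  weight.\<close>

lemma sum_weighted_mono:
  fixes f g w :: "nat \<Rightarrow> real"
  assumes le: "\<And>j. m \<le> j \<Longrightarrow> j \<le> n \<Longrightarrow> sum f {m..j} \<le> c + sum g {m..j}"
    and anti: "\<And>k. m \<le> k \<Longrightarrow> k < n \<Longrightarrow> w (Suc k) \<le> w k"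
    and "0 \<le> w n" "m \<le> n"
  shows "(\<Sum>k=m..n. f k * w k) \<le> c * w m + (\<Sum>k=m..n. g k * w k)"
proof -
  \<comment> \<open>Invariant: the slack up to \<open>j\<close>, at the current weight, is at most
    the weighted slack. Since the slack is nonnegative, lowering the weight to
    \<open>w (Suc j)\<close> preserves this.\<close>
  have "(c + sum g {m..j} - sum f {m..j}) * w j
      \<le> c * w m + (\<Sum>k=m..j. g k * w k) - (\<Sum>k=m..j. f k * w k)"
    if "m \<le> j" "j \<le> n" for j
    using that
  proof (induction j rule: dec_induct)
    case base
    show ?case by (simp add: algebra_simps)
  next
    case (step j)
    have "(c + sum g {m..j} - sum f {m..j}) * w (Suc j)
        \<le> (c + sum g {m..j} - sum f {m..j}) * w j"
      by (intro mult_left_mono anti) (use le[of j] step in auto)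
    then show ?case using step by (simp add: algebra_simps)
  qed
  from this[of n] show ?thesis
    using mult_nonneg_nonneg[of "c + sum g {m..n} - sum f {m..n}" "w n"] le[of n] assms(3,4)
    by linarith
qed

text \<open>Passing from n to n + 1 raises \<open>n div k\<close> by one exactly at the divisors k
  of n + 1, whose \<open>mangoldt\<close> values add up to ln (n + 1). The free upper limit
  \<open>N\<close> lets several factorials be expanded over one common range.\<close>

lemma ln_fact_eq_sum_mangoldt:
  assumes "n \<le> N"
  shows "ln (fact n) = (\<Sum>k=1..N. mangoldt k * real (n div k))"
proof -
  have "ln (fact n) = (\<Sum>k=1..n. mangoldt k * real (n div k))"
  proof (induction n)
    case (Suc n)
    have div: "Suc n div k = n div k + (if k dvd Suc n then 1 else 0)" for k
      by (simp add: div_Suc mod_eq_0_iff_dvd)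
    have "(\<Sum>k=1..Suc n. mangoldt k * real (Suc n div k))
        = (\<Sum>k=1..Suc n. mangoldt k * real (n div k))
          + (\<Sum>k=1..Suc n. if k dvd Suc n then mangoldt k else 0)"
      unfolding sum.distrib[symmetric] by (intro sum.cong) (auto simp: div algebra_simps)
    also have "(\<Sum>k=1..Suc n. mangoldt k * real (n div k)) = ln (fact n)"
      using Suc by simp
    also have "(\<Sum>k=1..Suc n. if k dvd Suc n then mangoldt k else 0)
        = (\<Sum>k | k dvd Suc n. mangoldt k :: real)"
      by (subst sum.inter_filter[symmetric])
         (auto intro!: sum.cong simp: Suc_le_eq dest: dvd_imp_le intro: dvd_pos_nat)
    also have "\<dots> = ln (real (Suc n))"
      using mangoldt_sum[of "Suc n", where ?'a = real] by simp
    finally show ?case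
      by (simp add: ln_mult)
  qed simp
  also have "\<dots> = (\<Sum>k=1..N. mangoldt k * real (n div k))"
    using assms by (intro sum.mono_neutral_left) auto
  finally show ?thesis .
qed

text \<open>In the expansion of the binomial coefficient, \<open>mangoldt k\<close> has coefficient
  \<open>(a + b) div k - a div k - b div k\<close>. This is nonnegative, and at least 1 for b < k <=
  a + b, where a <= b makes both subtracted quotients vanish.\<close>

lemma chebyshev_psi_add_le:
  assumes "a \<le> b"
  shows "chebyshev_psi (a + b) \<le> chebyshev_psi b + ln (real (a + b choose a))"
proof -
  have "ln (real (a + b choose a)) = ln (fact (a + b)) - ln (fact a) - ln (fact b)"
    by (simp add: binomial_fact ln_div ln_mult)
  also have "\<dots> = (\<Sum>k=1..a+b. mangoldt k * (real ((a + b) div k) - real (a div k) - real (b div k)))"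
    using ln_fact_eq_sum_mangoldt[of _ "a + b"]
    by (simp add: sum_subtractf right_diff_distrib)
  also have "\<dots> \<ge> (\<Sum>k=1..a+b. if k \<in> {b<..a+b} then mangoldt k else 0)"
  proof (intro sum_mono)
    fix k assume k: "k \<in> {1..a+b}"
    have "a div k + b div k \<le> (a + b) div k"
      by (simp add: div_add1_eq[of a b k])
    moreover have "1 \<le> (a + b) div k" "a div k = 0" "b div k = 0" if "b < k"
      using k that assms by (auto simp: Suc_le_eq div_greater_zero_iff)
    ultimately have "(if b < k then 1 else 0) \<le> real ((a + b) div k) - real (a div k) - real (b div k)"
      by (auto simp flip: of_nat_add)
    from mult_left_mono[OF this, of "mangoldt k"]
    show "(if k \<in> {b<..a+b} then mangoldt k else 0)
        \<le> mangoldt k * (real ((a + b) div k) - real (a div k) - real (b div k))"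
      using k by (auto simp: mangoldt_nonneg split: if_splits)
  qed
  also have "(\<Sum>k=1..a+b. if k \<in> {b<..a+b} then mangoldt k else 0)
      = (\<Sum>k\<in>{b<..a+b}. mangoldt k :: real)"
    by (subst sum.inter_restrict[symmetric]) (auto intro!: sum.cong)
  also have "\<dots> = chebyshev_psi (a + b) - chebyshev_psi b"
  proof -
    have *: "{1..a+b} = {1..b} \<union> {b<..a+b}" by auto
    have "chebyshev_psi (a + b) = chebyshev_psi b + (\<Sum>k\<in>{b<..a+b}. mangoldt k)"
      unfolding chebyshev_psi_def * by (rule sum.union_disjoint) auto
    then show ?thesis by linarith
  qed
  finally show ?thesis by simp
qed

text \<open>Strong induction by halving \<open>n\<close>. The binomial coefficient that appears is
  at most 4^m: for n = 2m by the full row sum, for n = 2m + 1 by the sum of the lower half of the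
  row.\<close>

lemma chebyshev_psi_le: "chebyshev_psi n \<le> real n * ln 4"
proof (induction n rule: less_induct)
  case (less n)
  have ln_le: "ln (real j) \<le> real m * ln 4" if "j \<le> 4 ^ m" "0 < j" for j m
  proof -
    have "real j \<le> 4 ^ m"
      using that by (metis of_nat_le_iff of_nat_numeral of_nat_power)
    then show ?thesis
      using that by (simp flip: ln_realpow)
  qed
  consider "n = 0 \<or> n = 1" | m where "n = m + m" "0 < m" | m where "n = m + (m + 1)" "0 < m"
    by (metis One_nat_def add.assoc add_0 evenE mult_2 not_gr_zero oddE)
  then show ?case
  proof cases
    case 1
    then show ?thesis by (auto simp: chebyshev_psi_def)
  next
    case (2 m)
    have "m + m choose m \<le> (\<Sum>k\<le>m+m. m + m choose k)"
      by (rule member_le_sum) auto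
    also have "\<dots> = 4 ^ m"
      by (simp only: choose_row_sum mult_2[symmetric] power_mult) simp
    finally have "ln (real (m + m choose m)) \<le> real m * ln 4"
      by (intro ln_le) auto
    moreover have "chebyshev_psi m \<le> real m * ln 4"
      using 2 by (intro less) auto
    moreover have "real n * ln 4 = real m * ln 4 + real m * ln 4"
      using 2 by (simp only: of_nat_add distrib_right)
    ultimately show ?thesis
      using chebyshev_psi_add_le[OF order_refl, of m] 2(1) by simp
  next
    case (3 m)
    have eq: "m + (m + 1) = 2 * m + 1" by simp
    have "m + (m + 1) choose m \<le> (\<Sum>k\<le>m. m + (m + 1) choose k)"
      by (rule member_le_sum) auto
    also have "\<dots> = 4 ^ m"
      unfolding eq binomial_r_part_sum by (simp add: power_mult)
    finally have "ln (real (m + (m + 1) choose m)) \<le> real m * ln 4"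
      by (intro ln_le) auto
    moreover have "chebyshev_psi (m + 1) \<le> real (m + 1) * ln 4"
      using 3 by (intro less) auto
    moreover have "real n * ln 4 = real m * ln 4 + real (m + 1) * ln 4"
      using 3 by (simp only: of_nat_add distrib_right)
    ultimately show ?thesis
      using chebyshev_psi_add_le[of m "m + 1"] 3 by simp
  qed
qed

section \<open>The Mertens sum compared with log n!, and Stirling's upper bound\<close>

lemma sum_inverse_le_ln:
  assumes "0 < h" "h \<le> j"
  shows "(\<Sum>k=Suc h..j. 1 / real k) \<le> ln (real j) - ln (real h)"
  using assms(2)
proof (induction j rule: dec_induct)
  case (step j)
  have "ln (real j / real (Suc j)) \<le> real j / real (Suc j) - 1"
    using step assms by (intro ln_le_minus_one) simp
  also have "\<dots> = - 1 / real (Suc j)"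
    by (simp add: field_simps)
  finally have "1 / real (Suc j) \<le> ln (real (Suc j)) - ln (real j)"
    using step assms by (simp add: ln_div)
  then show ?case using step by simp
qed simp

text \<open>Up to n/2 the minimum is bounded by 1, beyond that by n/k - 1; what remains is a
  harmonic sum over the upper half, of size about ln 2.\<close>

lemma sum_min_frac_le:
  assumes "0 < n"
  shows "(\<Sum>k=1..n. min (real n / real k - 1) 1) \<le> real n * ln 2"
proof -
  define h where "h = n div 2"
  have "{1..n} = {1..h} \<union> {Suc h..n}"
    unfolding h_def by auto
  then have "(\<Sum>k=1..n. min (real n / real k - 1) 1)
      = (\<Sum>k=1..h. min (real n / real k - 1) 1) + (\<Sum>k=Suc h..n. min (real n / real k - 1) 1)"
    by (simp add: sum.union_disjoint)
  also have "\<dots> \<le> (\<Sum>k=1..h. 1) + (\<Sum>k=Suc h..n. real n * (1 / real k) - 1)"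
    by (intro add_mono sum_mono) auto
  also have "\<dots> = 2 * real h - real n + real n * (\<Sum>k=Suc h..n. 1 / real k)"
    unfolding sum_distrib_left by (simp add: sum_subtractf h_def of_nat_diff)
  also have "\<dots> \<le> real n * ln 2"
  proof -
    have *: "(\<Sum>k=Suc h..2*h. 1 / real k) \<le> ln 2"
    proof (cases "h = 0")
      case False
      then show ?thesis
        using sum_inverse_le_ln[of h "2 * h"] by (simp add: ln_mult)
    qed simp
    show ?thesis
    proof (cases "even n")
      case True
      then have "n = 2 * h" by (simp add: h_def)
      then show ?thesis
        using mult_left_mono[OF *, of "real n"] by simp
    next
      case False
      then have n: "n = Suc (2 * h)" by (simp add: h_def)
      \<comment> \<open>For odd \<open>n\<close> the extra last term n (1/n) = 1 is cancelled by 2h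
        - n = -1.\<close>
      have "real n * (\<Sum>k=Suc h..n. 1 / real k) = real n * (\<Sum>k=Suc h..2*h. 1 / real k) + 1"
        using n by (simp add: algebra_simps)
      also have "\<dots> \<le> real n * ln 2 + 1"
        using * by (simp add: mult_left_mono)
      finally show ?thesis using n by simp
    qed
  qed
  finally show ?thesis .
qed

lemma mertens_sum_le_ln_fact:
  assumes "0 < n"
  shows "real n * mertens_sum n \<le> ln (fact n) + 2 * (ln 2)\<^sup>2 * real n"
proof -
  have ln4: "ln 4 = 2 * ln (2::real)"
    using ln_realpow[of 2 2] by simp
  have "real n * mertens_sum n - ln (fact n)
      = (\<Sum>k=1..n. mangoldt k * (real n / real k - real (n div k)))"
    by (simp add: mertens_sum_def ln_fact_eq_sum_mangoldt[of n n] sum_distrib_left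
        sum_subtractf right_diff_distrib mult.commute)
  also have "\<dots> \<le> (\<Sum>k=1..n. mangoldt k * min (real n / real k - 1) 1)"
  proof (intro sum_mono mult_left_mono)
    fix k assume k: "k \<in> {1..n}"
    then have "1 \<le> real (n div k)"
      by (simp add: Suc_le_eq div_greater_zero_iff)
    then show "real n / real k - real (n div k) \<le> min (real n / real k - 1) 1"
      using floor_divide_of_nat_eq[of n k, where ?'a = real] by linarith
  qed (rule mangoldt_nonneg)
  \<comment> \<open>The weight min(n/k - 1, 1) is nonincreasing in k, unlike the fractional part of
    n/k itself; hence partial summation may replace \<open>mangoldt k\<close> by the constant
    \<open>ln 4\<close>.\<close>
  also have "\<dots> \<le> 0 * min (real n / real 1 - 1) 1 + (\<Sum>k=1..n. ln 4 * min (real n / real k - 1) 1)"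
  proof (rule sum_weighted_mono)
    fix k :: nat assume "1 \<le> k"
    then have "real n / real (Suc k) \<le> real n / real k"
      by (intro divide_left_mono) auto
    then show "min (real n / real (Suc k) - 1) 1 \<le> min (real n / real k - 1) 1"
      by (intro min.mono) auto
  qed (use assms chebyshev_psi_le in \<open>auto simp: chebyshev_psi_def\<close>)
  also have "\<dots> = ln 4 * (\<Sum>k=1..n. min (real n / real k - 1) 1)"
    by (simp add: sum_distrib_left)
  also have "\<dots> \<le> ln 4 * (real n * ln 2)"
    using sum_min_frac_le[OF assms] by (intro mult_left_mono) auto
  finally show ?thesis
    by (simp add: ln4 power2_eq_square algebra_simps)
qed

text \<open>This is n! <= e sqrt(n) (n/e)^n. The induction step amounts to (n + 1/2) ln(1 + 1/n) >=
  1.\<close>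

lemma ln_fact_le:
  assumes "0 < n"
  shows "ln (fact n) \<le> 1 + ln (real n) / 2 + real n * ln (real n) - real n"
  using assms
proof (induction n rule: nat_induct_non_zero)
  case (Suc n)
  have "ln (real (Suc n)) - ln (real n) \<ge> 2 / (2 * real n + 1)"
    using ln_inverse_approx_ge[of "real n" "real (Suc n)"] Suc by (simp add: add.commute)
  then have "(real n + 1 / 2) * (ln (real (Suc n)) - ln (real n)) \<ge> 1"
    using Suc by (simp add: field_simps)
  moreover have "real (Suc n) * ln (real (Suc n)) = real n * ln (real (Suc n)) + ln (real (Suc n))"
    by (simp add: algebra_simps)
  moreover have "ln (fact (Suc n)) = ln (real (Suc n)) + ln (fact n)"
    by (simp add: ln_mult)
  ultimately show ?case
    using Suc.IH by (simp add: algebra_simps del: of_nat_Suc fact_Suc)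
qed simp

section \<open>Logarithm estimates and the Mertens bound for all n\<close>

lemma ln_2_bounds: "693 / 1000 \<le> ln (2::real)" "ln (2::real) \<le> 6932 / 10000"
  using ln_approx_bounds[of 2 3, simplified, simplified eval_nat_numeral, simplified]
  by (auto simp: power_numeral_reduce)

text \<open>
  All numerical estimates are made in units of \<open>ln 2\<close>, so that bounds on logarithms reduce to
  comparing powers of integers.
\<close>
lemma ln_le_of_power_le:
  assumes "x ^ k \<le> 2 ^ j" "0 < x" "0 < k"
  shows "ln (x::real) \<le> real j / real k * ln 2"
proof -
  have "real k * ln x \<le> real j * ln 2"
    using assms by (simp flip: ln_realpow)
  then show ?thesis using assms by (simp add: field_simps)
qed

lemma ln_ge_of_power_ge:
  assumes "2 ^ j \<le> x ^ k" "0 < x" "0 < k"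
  shows "real j / real k * ln 2 \<le> ln (x::real)"
proof -
  have "real j * ln 2 \<le> real k * ln x"
    using assms by (simp flip: ln_realpow)
  then show ?thesis using assms by (simp add: field_simps)
qed

text \<open>The leading error 0.9611 n leaves 0.0389 n of the -n in Stirling's bound to absorb 1 +
  (ln n)/2. The tangent of ln at 83 makes this a linear inequality, and 83 is the first integer
  satisfying it.\<close>

lemma mertens_sum_le_ln_large:
  assumes "83 \<le> n"
  shows "mertens_sum n \<le> ln (real n)"
proof -
  have "ln (83::real) \<le> 32 / 5 * ln 2"
    using ln_le_of_power_le[of 83 5 32] by simp
  moreover have "ln (real n) - ln 83 \<le> real n / 83 - 1"
    using ln_le_minus_one[of "real n / 83"] assms by (simp add: ln_div)
  ultimately have "1 + ln (real n) / 2 \<le> 272 / 100 + real n / 166"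
    using ln_2_bounds(2) by simp
  also have "\<dots> \<le> 389 / 10000 * real n"
    using assms by simp
  finally have *: "1 + ln (real n) / 2 \<le> 389 / 10000 * real n" .
  have "(ln 2)\<^sup>2 \<le> (6932 / 10000 :: real)\<^sup>2"
    using ln_2_bounds by (intro power_mono) auto
  then have "2 * (ln 2)\<^sup>2 * real n \<le> 9611 / 10000 * real n"
    by (intro mult_right_mono) (auto simp: power2_eq_square)
  then have "real n * mertens_sum n \<le> real n * ln (real n)"
    using mertens_sum_le_ln_fact[of n] ln_fact_le[of n] * assms by linarith
  then show ?thesis using assms by simp
qed

lemma mangoldt_eq_0_of_dvd:
  assumes "prime p" "prime q" "p \<noteq> q" "p dvd n" "q dvd n"
  shows "mangoldt n = (0 :: real)"
  using not_primepowI[OF assms] by (simp add: mangoldt_def)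

text \<open>All pairs of distinct primes with product at most 82, in order of the product: they
  cover every number from 2 to 82 that is not a prime power.\<close>

lemmas mangoldt_eq_0_of_dvd_numerals =
  mangoldt_eq_0_of_dvd[of 2 3, simplified] mangoldt_eq_0_of_dvd[of 2 5, simplified]
  mangoldt_eq_0_of_dvd[of 2 7, simplified] mangoldt_eq_0_of_dvd[of 3 5, simplified]
  mangoldt_eq_0_of_dvd[of 3 7, simplified] mangoldt_eq_0_of_dvd[of 2 11, simplified]
  mangoldt_eq_0_of_dvd[of 2 13, simplified] mangoldt_eq_0_of_dvd[of 3 11, simplified]
  mangoldt_eq_0_of_dvd[of 2 17, simplified] mangoldt_eq_0_of_dvd[of 5 7, simplified]
  mangoldt_eq_0_of_dvd[of 2 19, simplified] mangoldt_eq_0_of_dvd[of 3 13, simplified]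
  mangoldt_eq_0_of_dvd[of 2 23, simplified] mangoldt_eq_0_of_dvd[of 3 17, simplified]
  mangoldt_eq_0_of_dvd[of 5 11, simplified] mangoldt_eq_0_of_dvd[of 3 19, simplified]
  mangoldt_eq_0_of_dvd[of 2 29, simplified] mangoldt_eq_0_of_dvd[of 2 31, simplified]
  mangoldt_eq_0_of_dvd[of 5 13, simplified] mangoldt_eq_0_of_dvd[of 3 23, simplified]
  mangoldt_eq_0_of_dvd[of 2 37, simplified] mangoldt_eq_0_of_dvd[of 7 11, simplified]
  mangoldt_eq_0_of_dvd[of 2 41, simplified]

lemma mangoldt_eq_ln:
  assumes "prime p" "0 < k" "q = p ^ k"
  shows "mangoldt q = ln (real p)"
  using mangoldt_primepow'[OF assms(1,2), where ?'a = real] assms(3) by simp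

lemma mangoldt_numeral_primepow:
  "mangoldt 4 = ln (2::real)"
  "mangoldt 8 = ln (2::real)"
  "mangoldt 16 = ln (2::real)"
  "mangoldt 32 = ln (2::real)"
  "mangoldt 64 = ln (2::real)"
  "mangoldt 9 = ln (3::real)"
  "mangoldt 27 = ln (3::real)"
  "mangoldt 81 = ln (3::real)"
  "mangoldt 25 = ln (5::real)"
  "mangoldt 49 = ln (7::real)"
  by (simp_all add: mangoldt_eq_ln[of 2 2] mangoldt_eq_ln[of 2 3]
      mangoldt_eq_ln[of 2 4] mangoldt_eq_ln[of 2 5]
      mangoldt_eq_ln[of 2 6] mangoldt_eq_ln[of 3 2]
      mangoldt_eq_ln[of 3 3] mangoldt_eq_ln[of 3 4]
      mangoldt_eq_ln[of 5 2] mangoldt_eq_ln[of 7 2])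

text \<open>These are the odd primes up to 82, so with \<open>ln 2\<close> they suffice to evaluate
  the Mertens sum there. A factor j/k certifies p^k <= 2^j.\<close>

lemma ln_prime_upper_bounds:
  "ln (3::real) \<le> 27 / 17 * ln 2"
  "ln (5::real) \<le> 72 / 31 * ln 2"
  "ln (7::real) \<le> 31 / 11 * ln 2"
  "ln (11::real) \<le> 45 / 13 * ln 2"
  "ln (13::real) \<le> 26 / 7 * ln 2"
  "ln (17::real) \<le> 41 / 10 * ln 2"
  "ln (19::real) \<le> 17 / 4 * ln 2"
  "ln (23::real) \<le> 59 / 13 * ln 2"
  "ln (29::real) \<le> 39 / 8 * ln 2"
  "ln (31::real) \<le> 109 / 22 * ln 2"
  "ln (37::real) \<le> 47 / 9 * ln 2"
  "ln (41::real) \<le> 43 / 8 * ln 2"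
  "ln (43::real) \<le> 38 / 7 * ln 2"
  "ln (47::real) \<le> 39 / 7 * ln 2"
  "ln (53::real) \<le> 23 / 4 * ln 2"
  "ln (59::real) \<le> 53 / 9 * ln 2"
  "ln (61::real) \<le> 89 / 15 * ln 2"
  "ln (67::real) \<le> 73 / 12 * ln 2"
  "ln (71::real) \<le> 37 / 6 * ln 2"
  "ln (73::real) \<le> 31 / 5 * ln 2"
  "ln (79::real) \<le> 82 / 13 * ln 2"
  using ln_le_of_power_le[of 3 17 27]
    ln_le_of_power_le[of 5 31 72]
    ln_le_of_power_le[of 7 11 31]
    ln_le_of_power_le[of 11 13 45]
    ln_le_of_power_le[of 13 7 26]
    ln_le_of_power_le[of 17 10 41]
    ln_le_of_power_le[of 19 4 17]
    ln_le_of_power_le[of 23 13 59]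
    ln_le_of_power_le[of 29 8 39]
    ln_le_of_power_le[of 31 22 109]
    ln_le_of_power_le[of 37 9 47]
    ln_le_of_power_le[of 41 8 43]
    ln_le_of_power_le[of 43 7 38]
    ln_le_of_power_le[of 47 7 39]
    ln_le_of_power_le[of 53 4 23]
    ln_le_of_power_le[of 59 9 53]
    ln_le_of_power_le[of 61 15 89]
    ln_le_of_power_le[of 67 12 73]
    ln_le_of_power_le[of 71 6 37]
    ln_le_of_power_le[of 73 5 31]
    ln_le_of_power_le[of 79 13 82]
  by simp_all

text \<open>The arguments are the prime powers from 3 to 16, needed for the leading terms of the two
  series, and left ends of blocks in the check of the Mertens bound below 83.\<close>

lemma ln_lower_bounds:
  "19 / 12 * ln 2 \<le> ln (3::real)"
  "2 / 1 * ln 2 \<le> ln (4::real)"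
  "37 / 16 * ln 2 \<le> ln (5::real)"
  "14 / 5 * ln 2 \<le> ln (7::real)"
  "3 / 1 * ln 2 \<le> ln (8::real)"
  "19 / 6 * ln 2 \<le> ln (9::real)"
  "31 / 9 * ln 2 \<le> ln (11::real)"
  "37 / 10 * ln 2 \<le> ln (13::real)"
  "4 / 1 * ln 2 \<le> ln (16::real)"
  "29 / 6 * ln 2 \<le> ln (29::real)"
  "28 / 5 * ln 2 \<le> ln (49::real)"
  using ln_ge_of_power_ge[of 19 3 12]
    ln_ge_of_power_ge[of 2 4 1]
    ln_ge_of_power_ge[of 37 5 16]
    ln_ge_of_power_ge[of 14 7 5]
    ln_ge_of_power_ge[of 3 8 1]
    ln_ge_of_power_ge[of 19 9 6]
    ln_ge_of_power_ge[of 31 11 9]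
    ln_ge_of_power_ge[of 37 13 10]
    ln_ge_of_power_ge[of 4 16 1]
    ln_ge_of_power_ge[of 29 29 6]
    ln_ge_of_power_ge[of 28 49 5]
  by simp_all

lemma mertens_sum_1: "mertens_sum 1 = 0"
  by (simp add: mertens_sum_def)

lemma mertens_sum_Suc: "mertens_sum (Suc n) = mertens_sum n + mangoldt (Suc n) / real (Suc n)"
  by (simp add: mertens_sum_def)

lemma mertens_sum_numeral:
  "mertens_sum (numeral k) = mertens_sum (pred_numeral k) + mangoldt (numeral k) / numeral k"
  using mertens_sum_Suc[of "pred_numeral k"]
  by (simp only: numeral_eq_Suc[symmetric] of_nat_numeral)

lemma mertens_sum_mono:
  assumes "m \<le> n"
  shows "mertens_sum m \<le> mertens_sum n"
  unfolding mertens_sum_def using assms by (intro sum_mono2) (auto simp: mangoldt_nonneg)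

lemmas mertens_sum_eval =
  mertens_sum_numeral mertens_sum_1[unfolded One_nat_def] mangoldt_eq_0_of_dvd_numerals
  mangoldt_numeral_primepow

text \<open>Each argument from 4 on ends a block, and its constant stays below the one in
  \<open>ln_lower_bounds\<close> for the left end: 1.28 < 19/12, 2.272 < 37/16, 3.12 < 19/6, 3.93 <
  4, 4.81 < 29/6, 5.55 < 28/5.\<close>

lemma mertens_sum_upper_bounds:
  "mertens_sum 2 \<le> 1 / 2 * ln 2"
  "mertens_sum 4 \<le> 128 / 100 * ln 2"
  "mertens_sum 8 \<le> 2272 / 1000 * ln 2"
  "mertens_sum 16 \<le> 312 / 100 * ln 2"
  "mertens_sum 28 \<le> 393 / 100 * ln 2"
  "mertens_sum 48 \<le> 481 / 100 * ln 2"
  "mertens_sum 82 \<le> 555 / 100 * ln 2"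
proof -
  show "mertens_sum 2 \<le> 1 / 2 * ln 2"
    using ln_2_bounds(1) by (simp add: mertens_sum_eval)
  show "mertens_sum 4 \<le> 128 / 100 * ln 2"
    using ln_prime_upper_bounds(1) ln_2_bounds(1) by (simp add: mertens_sum_eval)
  show "mertens_sum 8 \<le> 2272 / 1000 * ln 2"
    using ln_prime_upper_bounds(1-3) ln_2_bounds(1) by (simp add: mertens_sum_eval)
  show "mertens_sum 16 \<le> 312 / 100 * ln 2"
    using ln_prime_upper_bounds(1-5) ln_2_bounds(1) by (simp add: mertens_sum_eval)
  show "mertens_sum 28 \<le> 393 / 100 * ln 2"
    using ln_prime_upper_bounds(1-8) ln_2_bounds(1) by (simp add: mertens_sum_eval)
  show "mertens_sum 48 \<le> 481 / 100 * ln 2"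
    using ln_prime_upper_bounds(1-14) ln_2_bounds(1) by (simp add: mertens_sum_eval)
  show "mertens_sum 82 \<le> 555 / 100 * ln 2"
    using ln_prime_upper_bounds(1-21) ln_2_bounds(1) by (simp add: mertens_sum_eval)
qed

lemma mertens_sum_le_ln:
  assumes "0 < n"
  shows "mertens_sum n \<le> ln (real n)"
proof -
  have *: "mertens_sum n \<le> ln (real n)" if "mertens_sum b \<le> ln (real a)" "a \<le> n" "n \<le> b" "0 < a" for a b
  proof -
    have "mertens_sum n \<le> ln (real a)"
      using mertens_sum_mono[OF that(3)] that(1) by simp
    also have "\<dots> \<le> ln (real n)"
      using that by simp
    finally show ?thesis .
  qed
  have "0 < ln (2::real)" by simp
  then have "mertens_sum 1 \<le> ln (real 1)" "mertens_sum 2 \<le> ln (real 2)"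
    "mertens_sum 4 \<le> ln (real 3)" "mertens_sum 8 \<le> ln (real 5)" "mertens_sum 16 \<le> ln (real 9)"
    "mertens_sum 28 \<le> ln (real 16)" "mertens_sum 48 \<le> ln (real 29)" "mertens_sum 82 \<le> ln (real 49)"
    using mertens_sum_upper_bounds ln_lower_bounds mertens_sum_1
    by (simp_all only: of_nat_numeral of_nat_1 ln_one)
  \<comment> \<open>As the sum is about \<open>ln n - 0.58\<close>, a bound at \<open>b\<close> settles a whole block \<open>{a..b}\<close>.\<close>
  note ** = this[THEN *]
  \<comment> \<open>The block from 17 to 28 is compared with \<open>ln 16\<close>, which is exactly
    4 \<open>ln 2\<close>.\<close>
  consider "n = 1" | "n = 2" | "3 \<le> n" "n \<le> 4" | "5 \<le> n" "n \<le> 8" | "9 \<le> n" "n \<le> 16"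
    | "17 \<le> n" "n \<le> 28" | "29 \<le> n" "n \<le> 48" | "49 \<le> n" "n \<le> 82" | "83 \<le> n"
    using assms by linarith
  then show ?thesis
    by cases (use mertens_sum_le_ln_large ** in auto)
qed

section \<open>Tails of series over prime powers\<close>

text \<open>A lower Riemann sum for the integral of 1/(c + t)^2 in t = ln k: for 0 < x <= y, (y -
  x)/y^2 <= 1/x - 1/y, which telescopes.\<close>

lemma sum_ln_diff_le:
  assumes "0 < a" "0 < c + ln (real a)" "a \<le> n"
  shows "(\<Sum>k=Suc a..n. (ln (real k) - ln (real (k - 1))) * (1 / (c + ln (real k))\<^sup>2))
    \<le> 1 / (c + ln (real a)) - 1 / (c + ln (real n))"
  using assms(3)
proof (induction n rule: dec_induct)
  case (step n)
  define x where "x = c + ln (real n)"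
  define y where "y = c + ln (real (Suc n))"
  have "ln (real a) \<le> ln (real n)" "ln (real n) \<le> ln (real (Suc n))"
    using step assms by auto
  then have xy: "0 < x" "x \<le> y" "0 < y"
    using assms(2) unfolding x_def y_def by linarith+
  have "(y - x) * (1 / y\<^sup>2) \<le> (y - x) * (1 / (x * y))"
    using xy by (intro mult_left_mono divide_left_mono) (auto simp: power2_eq_square)
  also have "\<dots> = 1 / x - 1 / y"
    using xy by (simp add: field_simps)
  finally have "(ln (real (Suc n)) - ln (real n)) * (1 / y\<^sup>2) \<le> 1 / x - 1 / y"
    by (simp add: x_def y_def)
  then show ?case
    using step unfolding x_def y_def by simp
qed simp

text \<open>By S(j) <= ln j, the sums of \<open>mangoldt q / q\<close> from a + 1 on exceed those of
  ln q - ln (q - 1) by at most ln a - S(a). Partial summation charges this excess at the first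
  weight; the increments of ln give the integral term.\<close>

lemma sum_mangoldt_tail_le:
  assumes "0 < a" "0 < c + ln (real a)"
  shows "(\<Sum>q=Suc a..n. mangoldt q / real q * (1 / (c + ln (real q))\<^sup>2))
    \<le> (ln (real a) - mertens_sum a) / (c + ln (real (Suc a)))\<^sup>2 + 1 / (c + ln (real a))"
proof (cases "a < n")
  case True
  have pos: "0 < c + ln (real k)" if "a \<le> k" for k
  proof -
    have "ln (real a) \<le> ln (real k)" using that assms by simp
    then show ?thesis using assms by linarith
  qed
  have "(\<Sum>q=Suc a..n. mangoldt q / real q * (1 / (c + ln (real q))\<^sup>2))
      \<le> (ln (real a) - mertens_sum a) * (1 / (c + ln (real (Suc a)))\<^sup>2)
        + (\<Sum>q=Suc a..n. (ln (real q) - ln (real (q - 1))) * (1 / (c + ln (real q))\<^sup>2))"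
  proof (rule sum_weighted_mono)
    fix j assume j: "Suc a \<le> j"
    have "{1..j} = {1..a} \<union> {Suc a..j}" using j by auto
    then have "(\<Sum>q=Suc a..j. mangoldt q / real q) = mertens_sum j - mertens_sum a"
      by (simp add: mertens_sum_def sum.union_disjoint)
    also have "\<dots> \<le> ln (real j) - mertens_sum a"
      using mertens_sum_le_ln[of j] j by simp
    also have "ln (real j) = ln (real a) + (\<Sum>q=Suc a..j. ln (real q) - ln (real (q - 1)))"
      using sum_telescope''[of a j "\<lambda>q. ln (real q)"] j by simp
    finally show "(\<Sum>q=Suc a..j. mangoldt q / real q) \<le> ln (real a) - mertens_sum a
        + (\<Sum>q=Suc a..j. ln (real q) - ln (real (q - 1)))"
      by simp
  next
    fix k assume k: "Suc a \<le> k"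
    show "1 / (c + ln (real (Suc k)))\<^sup>2 \<le> 1 / (c + ln (real k))\<^sup>2"
      using pos[of k] pos[of "Suc k"] k
      by (intro divide_left_mono power_mono mult_pos_pos) auto
  qed (use True in auto)
  also have "(\<Sum>q=Suc a..n. (ln (real q) - ln (real (q - 1))) * (1 / (c + ln (real q))\<^sup>2))
      \<le> 1 / (c + ln (real a)) - 1 / (c + ln (real n))"
    using assms True by (intro sum_ln_diff_le) auto
  also have "\<dots> \<le> 1 / (c + ln (real a))"
    using pos[of n] True by simp
  finally show ?thesis by simp
next
  case False
  then show ?thesis
    using assms mertens_sum_le_ln[of a] by simp
qed

section \<open>The descending Markov chain\<close>

text \<open>The decrease of \<open>N - m\<close> along a step towards multiples drives both the
  termination of \<open>chain_mass\<close> and the inductions over it.\<close>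

lemma chain_step_bounds:
  assumes "(q::nat) \<in> {2..N div m}"
  shows "0 < m" "m * q \<le> N" "m < m * q" "2 \<le> m * q" "N - m * q < N - m"
proof -
  show "0 < m"
    using assms by (cases m) auto
  then show "m * q \<le> N" "m < m * q"
    using assms by (auto simp: less_eq_div_iff_mult_less_eq mult.commute)
  then show "2 \<le> m * q" "N - m * q < N - m"
    using \<open>0 < m\<close> by linarith+
qed

text \<open>
  The chain is cut off at \<open>N\<close>: multiples \<open>m * q > N\<close> are dropped, which is harmless if \<open>A \<subseteq> {2..N}\<close>.
  For \<open>m = 0\<close> the sum is empty because \<open>N div 0 = 0\<close>.
\<close>
function chain_mass :: "nat set \<Rightarrow> nat \<Rightarrow> nat \<Rightarrow> real" where
  "chain_mass A N m = (if m \<in> A then 1 / (real m * ln (real m)) else 0)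
     + (\<Sum>q=2..N div m. chain_mass A N (m * q) * mangoldt q / ln (real (m * q)))"
  by auto
termination
  by (relation "Wellfounded.measure (\<lambda>(A, N, m). N - m)") (use chain_step_bounds in auto)

declare chain_mass.simps [simp del]

text \<open>Mass moves from a number to its divisors only, so \<open>m\<close> can be reached only
  from its multiples in \<open>A\<close>.\<close>

lemma chain_mass_eq_0:
  assumes "\<And>a. a \<in> A \<Longrightarrow> \<not> m dvd a"
  shows "chain_mass A N m = 0"
  using assms
proof (induction "N - m" arbitrary: m rule: less_induct)
  case less
  have "chain_mass A N (m * q) = 0" if q: "q \<in> {2..N div m}" for q
    using less.prems chain_step_bounds[OF q] by (intro less.hyps) (auto dest: dvd_mult_left)
  moreover have "m \<notin> A"
    using less.prems[of m] by auto
  ultimately show ?case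
    by (subst chain_mass.simps) simp
qed

text \<open>After division by ln n: the transition probabilities out of n >= 2 add up to 1. Leaving
  out q = 1, which would be a step from n to itself, costs nothing because its
  \<open>mangoldt\<close> value is 0.\<close>

lemma sum_mangoldt_divisors_ge_2:
  assumes "0 < n"
  shows "(\<Sum>q | 2 \<le> q \<and> q dvd n. mangoldt q) = ln (real n)"
proof -
  have "(\<Sum>q | 2 \<le> q \<and> q dvd n. mangoldt q) = (\<Sum>q | q dvd n. mangoldt q :: real)"
  proof (rule sum.mono_neutral_left)
    show "\<forall>q \<in> {q. q dvd n} - {q. 2 \<le> q \<and> q dvd n}. mangoldt q = (0::real)"
    proof
      fix q assume "q \<in> {q. q dvd n} - {q. 2 \<le> q \<and> q dvd n}"
      then have "q = 0 \<or> q = Suc 0" by auto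
      then show "mangoldt q = (0::real)" by auto
    qed
  qed (use assms in auto)
  then show ?thesis
    using mangoldt_sum[of n, where ?'a = real] assms by simp
qed

lemma chain_mass_1:
  assumes "A \<subseteq> {2..N}" "0 < N"
  shows "chain_mass A N 1 = (\<Sum>a\<in>A. 1 / (real a * ln (real a)))"
proof -
  define \<mu> where "\<mu> = chain_mass A N"
  define F where "F = (\<lambda>n. 1 / (real n * ln (real n)))"
  \<comment> \<open>Every \<open>n \<ge> 2\<close> passes on all of its mass, so summing the recurrence over \<open>m\<close> leaves only \<open>\<mu> 1\<close>.\<close>
  have "(\<Sum>m=1..N. \<mu> m) = (\<Sum>m=1..N. if m \<in> A then F m else 0)
      + (\<Sum>m=1..N. \<Sum>q=2..N div m. \<mu> (m * q) * mangoldt q / ln (real (m * q)))"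
    unfolding sum.distrib[symmetric] \<mu>_def F_def by (subst chain_mass.simps) simp
  also have "(\<Sum>m=1..N. if m \<in> A then F m else 0) = sum F A"
    using assms by (subst sum.inter_restrict[symmetric]) (auto intro!: sum.cong)
  also have "(\<Sum>m=1..N. \<Sum>q=2..N div m. \<mu> (m * q) * mangoldt q / ln (real (m * q)))
      = (\<Sum>(m, q)\<in>(SIGMA m:{1..N}. {2..N div m}). \<mu> (m * q) * mangoldt q / ln (real (m * q)))"
    by (rule sum.Sigma) auto
  \<comment> \<open>Arrivals at m from m q are regrouped as departures from n = m q.\<close>
  also have "\<dots> = (\<Sum>(n, q)\<in>(SIGMA n:{2..N}. {q. 2 \<le> q \<and> q dvd n}). \<mu> n * mangoldt q / ln (real n))"
  proof (rule sum.reindex_bij_witness[where i = "\<lambda>(n, q). (n div q, q)" and j = "\<lambda>(m, q). (m * q, q)"])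
    fix x assume "x \<in> (SIGMA m:{1..N}. {2..N div m})"
    then obtain m q where x: "x = (m, q)" and q: "q \<in> {2..N div m}" by auto
    with chain_step_bounds[OF q]
    show "(case (case x of (m, q) \<Rightarrow> (m * q, q)) of (n, q) \<Rightarrow> (n div q, q)) = x"
      "(case x of (m, q) \<Rightarrow> (m * q, q)) \<in> (SIGMA n:{2..N}. {q. 2 \<le> q \<and> q dvd n})"
      "(case (case x of (m, q) \<Rightarrow> (m * q, q)) of (n, q) \<Rightarrow> \<mu> n * mangoldt q / ln (real n))
        = (case x of (m, q) \<Rightarrow> \<mu> (m * q) * mangoldt q / ln (real (m * q)))"
      by auto
  next
    fix x assume "x \<in> (SIGMA n:{2..N}. {q. 2 \<le> q \<and> q dvd n})"
    then obtain m q where x: "x = (m * q, q)" and *: "2 \<le> m * q" "m * q \<le> N" "2 \<le> q"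
      by (auto elim!: dvdE simp: mult.commute)
    then have "0 < m" by (cases m) auto
    with x * show "(case (case x of (n, q) \<Rightarrow> (n div q, q)) of (m, q) \<Rightarrow> (m * q, q)) = x"
      "(case x of (n, q) \<Rightarrow> (n div q, q)) \<in> (SIGMA m:{1..N}. {2..N div m})"
      by (auto simp: less_eq_div_iff_mult_less_eq mult.commute intro: order_trans[OF _ *(2)])
  qed
  also have "\<dots> = (\<Sum>n=2..N. \<Sum>q | 2 \<le> q \<and> q dvd n. \<mu> n * mangoldt q / ln (real n))"
    by (rule sum.Sigma[symmetric]) auto
  also have "\<dots> = (\<Sum>n=2..N. \<mu> n)"
  proof (rule sum.cong)
    fix n assume n: "n \<in> {2..N}"
    then have "0 < ln (real n)" by simp
    with sum_mangoldt_divisors_ge_2[of n] n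
    show "(\<Sum>q | 2 \<le> q \<and> q dvd n. \<mu> n * mangoldt q / ln (real n)) = \<mu> n"
      by (simp flip: sum_divide_distrib sum_distrib_left)
  qed simp
  also have "(\<Sum>m=1..N. \<mu> m) = \<mu> 1 + (\<Sum>n=2..N. \<mu> n)"
    using assms(2) by (simp add: sum.atLeast_Suc_atMost numeral_2_eq_2)
  finally show ?thesis
    by (simp add: \<mu>_def F_def)
qed

text \<open>F(m q) times the transition probability is \<open>mangoldt q\<close> / (m q (ln m + ln
  q)^2). The bound on the mass is assumed only at the proper multiples m q, so that the lemma fits
  inside the induction for \<open>chain_mass_le\<close>.\<close>

lemma chain_inflow_le:
  assumes "2 \<le> m"
    and "\<And>q. q \<in> {2..N div m} \<Longrightarrow> chain_mass A N (m * q) \<le> 1 / (real (m * q) * ln (real (m * q)))"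
  shows "(\<Sum>q=2..N div m. chain_mass A N (m * q) * mangoldt q / ln (real (m * q)))
    \<le> 1 / real m * (\<Sum>q=2..N div m. mangoldt q / real q * (1 / (ln (real m) + ln (real q))\<^sup>2))"
  unfolding sum_distrib_left
proof (rule sum_mono)
  fix q assume q: "q \<in> {2..N div m}"
  have ln: "ln (real (m * q)) = ln (real m) + ln (real q)"
    using q assms(1) by (simp add: ln_mult)
  have nonneg: "0 \<le> ln (real (m * q))"
    using q assms(1) unfolding ln by simp
  have "chain_mass A N (m * q) * mangoldt q / ln (real (m * q))
      \<le> 1 / (real (m * q) * ln (real (m * q))) * mangoldt q / ln (real (m * q))"
    using assms(2)[OF q] nonneg by (intro divide_right_mono mult_right_mono mangoldt_nonneg)
  also have "\<dots> = 1 / real m * (mangoldt q / real q * (1 / (ln (real m) + ln (real q))\<^sup>2))"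
    unfolding ln by (simp add: power2_eq_square)
  finally show "chain_mass A N (m * q) * mangoldt q / ln (real (m * q))
      \<le> 1 / real m * (mangoldt q / real q * (1 / (ln (real m) + ln (real q))\<^sup>2))" .
qed

text \<open>Induction from large \<open>m\<close> downwards. At m in A primitivity excludes further
  multiples in A, so nothing flows in and the mass is exactly F(m); otherwise the inflow is bounded
  by superharmonicity of F.\<close>

lemma chain_mass_le:
  assumes "primitive A" "2 \<le> m"
  shows "chain_mass A N m \<le> 1 / (real m * ln (real m))"
  using assms(2)
proof (induction "N - m" arbitrary: m rule: less_induct)
  case (less m)
  show ?case
  proof (cases "m \<in> A")
    case True
    have "chain_mass A N (m * q) = 0" if q: "q \<in> {2..N div m}" for q
    proof (rule chain_mass_eq_0)
      fix a assume "a \<in> A"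
      then show "\<not> m * q dvd a"
        using assms(1) True chain_step_bounds[OF q] unfolding primitive_def
        by (metis dvd_imp_le dvd_mult_left mult_is_0 not_gr_zero not_le)
    qed
    then show ?thesis
      using True by (subst chain_mass.simps) simp
  next
    case False
    have "chain_mass A N m
        = (\<Sum>q=2..N div m. chain_mass A N (m * q) * mangoldt q / ln (real (m * q)))"
      using False by (subst chain_mass.simps) simp
    also have "\<dots> \<le> 1 / real m
        * (\<Sum>q=2..N div m. mangoldt q / real q * (1 / (ln (real m) + ln (real q))\<^sup>2))"
    proof (rule chain_inflow_le)
      fix q assume q: "q \<in> {2..N div m}"
      show "chain_mass A N (m * q) \<le> 1 / (real (m * q) * ln (real (m * q)))"
        using chain_step_bounds[OF q] less.prems by (intro less.hyps) auto
    qed (use less.prems in auto)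
    \<comment> \<open>At a = 1 the excess ln 1 - S(1) is 0, so the tail bound with c = ln m is
      exactly 1/ln m.\<close>
    also have "\<dots> \<le> 1 / real m * (1 / ln (real m))"
      using sum_mangoldt_tail_le[of 1 "ln (real m)" "N div m"] less.prems mertens_sum_1
      by (intro mult_left_mono) (simp_all add: numeral_2_eq_2)
    finally show ?thesis by simp
  qed
qed

text \<open>The mass entering 1 is split by its last stop q. At q = 2 there is only inflow, since 2
  is not in A; for q >= 3 the bound F(q) is used. The summand 0 matches the shape c + ln q of the
  tail bounds.\<close>

lemma erdos_sum_finite_le:
  assumes "primitive A" "2 \<notin> A" "A \<subseteq> {2..N}" "2 \<le> N"
  shows "(\<Sum>a\<in>A. 1 / (real a * ln (real a)))
    \<le> 1 / 2 * (\<Sum>q=2..N div 2. mangoldt q / real q * (1 / (ln 2 + ln (real q))\<^sup>2))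
      + (\<Sum>q=3..N. mangoldt q / real q * (1 / (0 + ln (real q))\<^sup>2))"
proof -
  have "(\<Sum>a\<in>A. 1 / (real a * ln (real a))) = chain_mass A N 1"
    using chain_mass_1[of A N] assms by simp
  also have "\<dots> = (\<Sum>q=2..N. chain_mass A N q * mangoldt q / ln (real q))"
    using assms(3) by (subst chain_mass.simps) auto
  \<comment> \<open>The step from 2 to 1 has probability \<open>mangoldt 2 / ln 2\<close> =
    1.\<close>
  also have "\<dots> = chain_mass A N 2 + (\<Sum>q=3..N. chain_mass A N q * mangoldt q / ln (real q))"
  proof -
    have "{2..N} = insert 2 {3..N}" using assms(4) by auto
    then show ?thesis by simp
  qed
  also have "chain_mass A N 2 = (\<Sum>q=2..N div 2. chain_mass A N (2 * q) * mangoldt q / ln (real (2 * q)))"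
    using assms(2) by (subst chain_mass.simps) simp
  also have "\<dots> \<le> 1 / real 2 * (\<Sum>q=2..N div 2. mangoldt q / real q * (1 / (ln (real 2) + ln (real q))\<^sup>2))"
    using assms(1) by (intro chain_inflow_le chain_mass_le) auto
  also have "(\<Sum>q=3..N. chain_mass A N q * mangoldt q / ln (real q))
      \<le> (\<Sum>q=3..N. mangoldt q / real q * (1 / (0 + ln (real q))\<^sup>2))"
  proof (rule sum_mono)
    fix q assume q: "q \<in> {3..N}"
    then have "chain_mass A N q * mangoldt q / ln (real q) \<le> 1 / (real q * ln (real q)) * mangoldt q / ln (real q)"
      using assms(1) by (intro divide_right_mono mult_right_mono chain_mass_le) (auto simp: mangoldt_nonneg)
    then show "chain_mass A N q * mangoldt q / ln (real q) \<le> mangoldt q / real q * (1 / (0 + ln (real q))\<^sup>2)"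
      by (simp add: power2_eq_square)
  qed
  finally show ?thesis by simp
qed

section \<open>Numerical evaluation of the two series\<close>

text \<open>With the shift also in units of \<open>ln 2\<close> (c = 0 and c = 1 give the two
  series), every term becomes a rational multiple of 1 / \<open>ln 2\<close>.\<close>

lemma mangoldt_term_le:
  assumes "mangoldt q \<le> u * ln 2" "l * ln 2 \<le> ln (real q)" "0 \<le> c" "0 < l" "0 < q"
  shows "mangoldt q / real q * (1 / (c * ln 2 + ln (real q))\<^sup>2)
    \<le> u / (real q * (c + l)\<^sup>2) * (1 / ln 2)"
proof -
  have pos: "0 < (c + l) * ln 2"
    using assms by simp
  have "mangoldt q / real q * (1 / (c * ln 2 + ln (real q))\<^sup>2)
      \<le> u * ln 2 / real q * (1 / ((c + l) * ln 2)\<^sup>2)"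
  proof (intro mult_mono divide_right_mono divide_left_mono power_mono mult_pos_pos zero_less_power)
    show "(c + l) * ln 2 \<le> c * ln 2 + ln (real q)" "0 < c * ln 2 + ln (real q)"
      using assms pos by (auto simp: algebra_simps)
    show "0 \<le> u * ln 2 / real q"
      using assms mangoldt_nonneg[of q] by (intro divide_nonneg_nonneg) linarith+
  qed (use assms pos in auto)
  also have "\<dots> = u / (real q * (c + l)\<^sup>2) * (1 / ln 2)"
    by (simp add: power_mult_distrib power2_eq_square)
  finally show ?thesis .
qed

text \<open>The tail bound at a = 16, where ln 16 = 4 \<open>ln 2\<close> is exact; S(16) >= 3.08
  \<open>ln 2\<close> leaves the excess 0.92 \<open>ln 2\<close>, and \<open>ln 17\<close> in the
  first weight is lowered to \<open>ln 16\<close>.\<close>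

lemma sum_mangoldt_split_16_le:
  assumes "m \<le> 17" "0 \<le> c"
  shows "(\<Sum>q=m..n. mangoldt q / real q * (1 / (c * ln 2 + ln (real q))\<^sup>2))
    \<le> (\<Sum>q=m..16. mangoldt q / real q * (1 / (c * ln 2 + ln (real q))\<^sup>2))
      + (92 / 100 / (c + 4)\<^sup>2 + 1 / (c + 4)) * (1 / ln 2)"
proof -
  let ?t = "\<lambda>q. mangoldt q / real q * (1 / (c * ln 2 + ln (real q))\<^sup>2)"
  have ln16: "ln 16 = 4 * ln (2::real)"
    using ln_realpow[of 2 4] by simp
  have ln17: "4 * ln 2 \<le> ln (17::real)"
    unfolding ln16[symmetric] by simp
  have pos: "0 < (c + 4) * ln (2::real)"
    using assms(2) by simp
  have scale: "92 / 100 * ln 2 / (d * ln 2)\<^sup>2 + 1 / (d * ln 2) = (92 / 100 / d\<^sup>2 + 1 / d) * (1 / ln 2)"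
    if "0 < d" for d :: real
    using that by (simp add: power2_eq_square field_simps)
  have "308 / 100 * ln 2 \<le> mertens_sum 16"
    using ln_lower_bounds ln_2_bounds(1) by (simp add: mertens_sum_eval)
  then have *: "ln 16 - mertens_sum 16 \<le> 92 / 100 * ln 2"
    using ln16 by simp
  have "sum ?t {m..n} \<le> sum ?t ({m..16} \<union> {17..n})"
    by (intro sum_mono2) (auto simp: mangoldt_nonneg)
  also have "\<dots> = sum ?t {m..16} + sum ?t {17..n}"
    by (intro sum.union_disjoint) auto
  also have "sum ?t {17..n} \<le> (ln 16 - mertens_sum 16) / (c * ln 2 + ln 17)\<^sup>2 + 1 / (c * ln 2 + ln 16)"
    using sum_mangoldt_tail_le[of 16 "c * ln 2" n] pos by (simp add: ln16 algebra_simps)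
  also have "\<dots> \<le> 92 / 100 * ln 2 / ((c + 4) * ln 2)\<^sup>2 + 1 / ((c + 4) * ln 2)"
  proof (intro add_mono frac_le power_mono zero_less_power)
    show "(c + 4) * ln 2 \<le> c * ln 2 + ln 17" "(c + 4) * ln 2 \<le> c * ln 2 + ln 16"
      using ln16 ln17 by (auto simp: algebra_simps)
  qed (use * pos in auto)
  also have "\<dots> = (92 / 100 / (c + 4)\<^sup>2 + 1 / (c + 4)) * (1 / ln 2)"
    using scale[of "c + 4"] assms(2) by simp
  finally show ?thesis by simp
qed

lemma sum_mangoldt_3_16_le:
  assumes "0 \<le> c"
  shows "(\<Sum>q=3..16. mangoldt q / real q * (1 / (c * ln 2 + ln (real q))\<^sup>2))
    \<le> (27 / 17 / (real 3 * (c + 19 / 12)\<^sup>2) + 1 / (real 4 * (c + 2)\<^sup>2) + 72 / 31 / (real 5 * (c + 37 / 16)\<^sup>2)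
      + 31 / 11 / (real 7 * (c + 14 / 5)\<^sup>2) + 1 / (real 8 * (c + 3)\<^sup>2) + 27 / 17 / (real 9 * (c + 19 / 6)\<^sup>2)
      + 45 / 13 / (real 11 * (c + 31 / 9)\<^sup>2) + 26 / 7 / (real 13 * (c + 37 / 10)\<^sup>2) + 1 / (real 16 * (c + 4)\<^sup>2)) * (1 / ln 2)"
proof -
  let ?t = "\<lambda>q. mangoldt q / real q * (1 / (c * ln 2 + ln (real q))\<^sup>2)"
  have *: "{3..16} = {3,4,5,6,7,8,9,10,11,12,13,14,15,16::nat}"
    by (simp add: atLeastAtMost_upt)
  have "sum ?t {3..16} = ?t 3 + ?t 4 + ?t 5 + ?t 7 + ?t 8 + ?t 9 + ?t 11 + ?t 13 + ?t 16"
    unfolding * by (simp add: mangoldt_eq_0_of_dvd_numerals)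
  also have "\<dots> \<le> (27 / 17 / (real 3 * (c + 19 / 12)\<^sup>2) + 1 / (real 4 * (c + 2)\<^sup>2) + 72 / 31 / (real 5 * (c + 37 / 16)\<^sup>2)
      + 31 / 11 / (real 7 * (c + 14 / 5)\<^sup>2) + 1 / (real 8 * (c + 3)\<^sup>2) + 27 / 17 / (real 9 * (c + 19 / 6)\<^sup>2)
      + 45 / 13 / (real 11 * (c + 31 / 9)\<^sup>2) + 26 / 7 / (real 13 * (c + 37 / 10)\<^sup>2) + 1 / (real 16 * (c + 4)\<^sup>2)) * (1 / ln 2)"
    unfolding distrib_right
    by (intro add_mono mangoldt_term_le)
       (use assms ln_prime_upper_bounds ln_lower_bounds in \<open>simp_all add: mangoldt_numeral_primepow\<close>)
  finally show ?thesis .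
qed

lemma sum_mangoldt_ln_le:
  "(\<Sum>q=3..n. mangoldt q / real q * (1 / (0 + ln (real q))\<^sup>2)) \<le> 80222 / 100000 * (1 / ln 2)"
proof -
  let ?t = "\<lambda>q. mangoldt q / real q * (1 / (0 + ln (real q))\<^sup>2)"
  have "sum ?t {3..n} \<le> sum ?t {3..16} + (92 / 100 / (0 + 4)\<^sup>2 + 1 / (0 + 4)) * (1 / ln 2)"
    by (rule sum_mangoldt_split_16_le[of 3 0 n, unfolded mult_zero_left]) simp_all
  \<comment> \<open>The tail is 0.92/16 + 1/4 = 0.3075.\<close>
  also have "\<dots> \<le> 49472 / 100000 * (1 / ln 2) + 3075 / 10000 * (1 / ln 2)"
    by (intro add_mono order_trans[OF sum_mangoldt_3_16_le[of 0, unfolded mult_zero_left]] mult_right_mono)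
       (simp_all add: power2_eq_square)
  finally show ?thesis by linarith
qed

lemma sum_mangoldt_ln_double_le:
  "(\<Sum>q=2..n. mangoldt q / real q * (1 / (ln 2 + ln (real q))\<^sup>2)) \<le> 58851 / 100000 * (1 / ln 2)"
proof -
  let ?t = "\<lambda>q. mangoldt q / real q * (1 / (ln 2 + ln (real q))\<^sup>2)"
  have "sum ?t {2..n} \<le> sum ?t {2..16} + (92 / 100 / (1 + 4)\<^sup>2 + 1 / (1 + 4)) * (1 / ln 2)"
    by (rule sum_mangoldt_split_16_le[of 2 1 n, unfolded mult_1]) simp_all
  also have "{2..16} = insert 2 {3..16::nat}"
    by auto
  also have "sum ?t (insert 2 {3..16}) = ?t 2 + sum ?t {3..16}"
    by (rule sum.insert) auto
  also have "?t 2 = 1 / 8 * (1 / ln 2)"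
    by (simp add: power2_eq_square)
  \<comment> \<open>The term q = 2 is exact, and the tail is 0.92/25 + 1/5 = 0.2368.\<close>
  also have "1 / 8 * (1 / ln 2) + sum ?t {3..16} + (92 / 100 / (1 + 4)\<^sup>2 + 1 / (1 + 4)) * (1 / ln 2)
      \<le> 1 / 8 * (1 / ln 2) + 22671 / 100000 * (1 / ln 2) + 2368 / 10000 * (1 / ln 2)"
    by (intro add_mono order_refl order_trans[OF sum_mangoldt_3_16_le[of 1, unfolded mult_1]] mult_right_mono)
       (simp_all add: power2_eq_square)
  finally show ?thesis by linarith
qed

section \<open>Passage from finite subsets to the infinite sum\<close>

theorem theorem4p4:
  fixes A :: "nat set"
  assumes "primitive A" and "2 \<notin> A"
  shows "(\<lambda>a. 1 / (real a * ln (real a))) summable_on A \<and> erdos_sum A < 1.60"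
proof -
  define F where "F = (\<lambda>a. 1 / (real a * ln (real a)))"
  have A: "A \<subseteq> {2..}"
    using assms(1) by (simp add: primitive_def)
  \<comment> \<open>The numbers give 1.096475/0.693 < 1.583. A uniform bound strictly below 1.60
    keeps the inequality strict in the limit.\<close>
  have bound: "sum F B \<le> 159 / 100" if B: "finite B" "B \<subseteq> A" for B
  proof -
    \<comment> \<open>Inserting 2 makes the maximum meaningful for empty \<open>B\<close> and
      ensures 2 <= N.\<close>
    define N where "N = Max (insert 2 B)"
    have "B \<subseteq> {2..N}" "2 \<le> N"
      using A B by (auto simp: N_def)
    moreover have "primitive B" "2 \<notin> B"
      using assms B by (auto simp: primitive_def)
    ultimately have "sum F B \<le> (1 / 2 * (58851 / 100000) + 80222 / 100000) * (1 / ln 2)"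
      using erdos_sum_finite_le[of B N] sum_mangoldt_ln_double_le[of "N div 2"] sum_mangoldt_ln_le[of N]
      by (simp add: F_def)
    also have "1 / ln 2 \<le> 1 / (693 / 1000 :: real)"
      using ln_2_bounds by (intro divide_left_mono) auto
    finally show ?thesis by simp
  qed
  have "F summable_on A"
  proof (rule nonneg_bdd_above_summable_on)
    show "0 \<le> F a" if "a \<in> A" for a
      using that A by (auto simp: F_def)
    show "bdd_above (sum F ` {B. B \<subseteq> A \<and> finite B})"
      using bound by (intro bdd_aboveI2[where M = "159 / 100"]) auto
  qed
  moreover have "infsum F A \<le> 159 / 100"
    using \<open>F summable_on A\<close> bound by (rule infsum_le_finite_sums)
  ultimately show ?thesis
    by (simp add: F_def erdos_sum_def)
qed

end
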